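(* Let $q$ be a prime power and $m\ge 0$ an integer. Then the operator $P_m$ is compact on the Hilbert space $\ell^2(\pi_m)$, and its set of eigenvalues is exactly $\{q^{-k}: k\ge 0\}$.
   Context: For $k\in\{0,1,\dots,\infty\}$, $\eta_k(q)=\prod_{j=1}^k(1-q^{-j})$. $P_m$ is the transition matrix on $\mathbb{Z}_{\ge0}$ given by $P_m(i,i+1)=q^{-1-2i-m}$, $P_m(i,i)=1-(1-q^{-i})(1-q^{-m-i})-q^{-1-2i-m}$, $P_m(i,i-1)=(1-q^{-i})(1-q^{-m-i})$ (for $i\ge1$), and $P_m(i,j)=0$ otherwise. It is irreducible, aperiodic and reversible with respect to its stationary distribution $$\pi_m(i)=\frac{\eta_\infty(q)}{q^{i(i+m)}\eta_i(q)\eta_{i+m}(q)},\quad i\ge0.$$ For a strictly positive probability distribution $\pi$ on $\mathbb{Z}_{\ge 0}$, $\ell^2(\pi)$ is the Hilbert space of complex sequences $\mu=(\mu(i))_{i\ge0}$ with $\sum_i|\mu(i)|^2/\pi(i)<\infty$, with inner product $\langle\mu,\nu\rangle_\pi=\sum_i\mu(i)\overline{\nu(i)}/\pi(i)$. A transition matrix $P$ reversible with respect to $\pi$ acts on $\ell^2(\pi)$ as a bounded self-adjoint operator by $\mu\mapsto\mu P$, $(\mu P)(j)=\sum_i\mu(i)P(i,j)$. *)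

theory Defs
  imports "HOL-Analysis.Analysis" "HOL-Library.Extended_Nat" "HOL-Number_Theory.Prime_Powers"
begin

definition eta :: "real \<Rightarrow> enat \<Rightarrow> real" where
  "eta q k = (case k of
      enat n \<Rightarrow> (\<Prod>j=1..n. 1 - q powi (- int j))
    | \<infinity> \<Rightarrow> prodinf (\<lambda>j. 1 - q powi (- int (Suc j))))"

definition P_matrix :: "real \<Rightarrow> nat \<Rightarrow> nat \<Rightarrow> nat \<Rightarrow> real" where
  "P_matrix q m i j =
    (if j = i + 1 then q powi (- 1 - 2 * int i - int m)
     else if j = i then
       1 - (1 - q powi (- int i)) * (1 - q powi (- int m - int i))
         - q powi (- 1 - 2 * int i - int m)
     else if i \<ge> 1 \<and> j = i - 1 then (1 - q powi (- int i)) * (1 - q powi (- int m - int i))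
     else 0)"

definition pi_dist :: "real \<Rightarrow> nat \<Rightarrow> nat \<Rightarrow> real" where
  "pi_dist q m i =
    eta q \<infinity> / (q ^ (i * (i + m)) * eta q (enat i) * eta q (enat (i + m)))"

text \<open>
  The space \<open>\<ell>\<^sup>2(w)\<close> for a strictly positive weight \<open>w\<close>. As \<open>w\<close> is a term and not a type, the
  space is a carrier set of sequences with an explicit inner product, norm and distance. Note
  that one divides by the weight. All sums are unconditional; those in the inner product
  of two elements of the carrier converge absolutely.
\<close>

definition l2_space :: "(nat \<Rightarrow> real) \<Rightarrow> (nat \<Rightarrow> complex) set" where
  "l2_space w = {\<mu>. (\<lambda>i. (cmod (\<mu> i))\<^sup>2 / w i) summable_on UNIV}"

definition l2_inner :: "(nat \<Rightarrow> real) \<Rightarrow> (nat \<Rightarrow> complex) \<Rightarrow> (nat \<Rightarrow> complex) \<Rightarrow> complex" where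
  "l2_inner w \<mu> \<nu> = (\<Sum>\<^sub>\<infinity>i. \<mu> i * cnj (\<nu> i) / of_real (w i))"

definition l2_norm :: "(nat \<Rightarrow> real) \<Rightarrow> (nat \<Rightarrow> complex) \<Rightarrow> real" where
  "l2_norm w \<mu> = sqrt (Re (l2_inner w \<mu> \<mu>))"

definition l2_dist :: "(nat \<Rightarrow> real) \<Rightarrow> (nat \<Rightarrow> complex) \<Rightarrow> (nat \<Rightarrow> complex) \<Rightarrow> real" where
  "l2_dist w \<mu> \<nu> = l2_norm w (\<lambda>i. \<mu> i - \<nu> i)"

definition l2_linear ::
    "(nat \<Rightarrow> real) \<Rightarrow> ((nat \<Rightarrow> complex) \<Rightarrow> (nat \<Rightarrow> complex)) \<Rightarrow> bool" where
  "l2_linear w T \<longleftrightarrow>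
    T \<in> l2_space w \<rightarrow> l2_space w \<and>
    (\<forall>\<mu>\<in>l2_space w. \<forall>\<nu>\<in>l2_space w. \<forall>a b.
       T (\<lambda>i. a * \<mu> i + b * \<nu> i) = (\<lambda>i. a * T \<mu> i + b * T \<nu> i))"

definition l2_compact_operator ::
    "(nat \<Rightarrow> real) \<Rightarrow> ((nat \<Rightarrow> complex) \<Rightarrow> (nat \<Rightarrow> complex)) \<Rightarrow> bool" where
  "l2_compact_operator w T \<longleftrightarrow>
    l2_linear w T \<and>
    (\<forall>B. Metric_space.mbounded (l2_space w) (l2_dist w) B \<longrightarrow>
       compactin (Metric_space.mtopology (l2_space w) (l2_dist w))
         (Metric_space.mtopology (l2_space w) (l2_dist w) closure_of (T ` B)))"

definition l2_eigenvalues ::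
    "(nat \<Rightarrow> real) \<Rightarrow> ((nat \<Rightarrow> complex) \<Rightarrow> (nat \<Rightarrow> complex)) \<Rightarrow> complex set" where
  "l2_eigenvalues w T =
    {c. \<exists>\<mu>\<in>l2_space w. \<mu> \<noteq> (\<lambda>i. 0) \<and> T \<mu> = (\<lambda>i. c * \<mu> i)}"

definition matrix_action ::
    "(nat \<Rightarrow> nat \<Rightarrow> real) \<Rightarrow> (nat \<Rightarrow> complex) \<Rightarrow> (nat \<Rightarrow> complex)" where
  "matrix_action P \<mu> = (\<lambda>j. \<Sum>\<^sub>\<infinity>i. \<mu> i * of_real (P i j))"

text \<open>
  The locale predicate below is what gives \<^const>\<open>Metric_space.mtopology\<close> and
  \<^const>\<open>Metric_space.mbounded\<close> their usual meaning on \<^const>\<open>l2_space\<close>.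
\<close>

lemma l2_norm_eq: "l2_norm w \<mu> = sqrt (\<Sum>\<^sub>\<infinity>i. (cmod (\<mu> i))\<^sup>2 / w i)"
proof -
  have "l2_inner w \<mu> \<mu> = (\<Sum>\<^sub>\<infinity>i. complex_of_real ((cmod (\<mu> i))\<^sup>2 / w i))"
    unfolding l2_inner_def by (simp add: complex_norm_square del: of_real_power)
  also have "\<dots> = complex_of_real (\<Sum>\<^sub>\<infinity>i. (cmod (\<mu> i))\<^sup>2 / w i)"
    by (rule infsum_bounded_linear_strong)
      (auto dest: summable_on_Re simp: summable_on_of_real bounded_linear_of_real
        simp del: of_real_divide of_real_power)
  finally show ?thesis by (simp add: l2_norm_def)
qed

lemma Metric_space_l2:
  assumes w: "\<And>i. w i > 0"
  shows "Metric_space (l2_space w) (l2_dist w)"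
proof
  fix x y
  show "0 \<le> l2_dist w x y"
    unfolding l2_dist_def l2_norm_eq using w by (auto intro!: infsum_nonneg simp: less_imp_le)
  show "l2_dist w x y = l2_dist w y x"
    unfolding l2_dist_def l2_norm_eq by (simp add: norm_minus_commute)
next
  have bd: "L2_set (\<lambda>i. cmod (x i - z i) / sqrt (w i)) F
      \<le> L2_set (\<lambda>i. cmod (x i - y i) / sqrt (w i)) F
        + L2_set (\<lambda>i. cmod (y i - z i) / sqrt (w i)) F" for x y z F
    using w by (intro order_trans[OF L2_set_mono L2_set_triangle_ineq])
      (auto simp: add_divide_distrib[symmetric] less_imp_le
        intro!: divide_right_mono norm_diff_triangle_le[OF order_refl order_refl])
  have L2: "L2_set (\<lambda>i. cmod (x i) / sqrt (w i)) F = sqrt (\<Sum>i\<in>F. (cmod (x i))\<^sup>2 / w i)"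
    for x F using w by (simp add: L2_set_def power_divide less_imp_le)
  have le: "sqrt (\<Sum>i\<in>F. (cmod (x i))\<^sup>2 / w i) \<le> l2_norm w x"
    if "x \<in> l2_space w" "finite F" for x F
    unfolding l2_norm_eq using that w unfolding l2_space_def
    by (intro real_sqrt_le_mono finite_sum_le_infsum) (auto simp: less_imp_le)
  have *: "(\<lambda>i. (cmod (x i))\<^sup>2 / w i) summable_on UNIV \<and> l2_norm w x \<le> C"
    if "\<And>F. finite F \<Longrightarrow> sqrt (\<Sum>i\<in>F. (cmod (x i))\<^sup>2 / w i) \<le> C" for x C
  proof -
    have C: "0 \<le> C" using that[of "{}"] by simp
    have F: "(\<Sum>i\<in>F. (cmod (x i))\<^sup>2 / w i) \<le> C\<^sup>2" if "finite F" for F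
      using \<open>\<And>F. finite F \<Longrightarrow> _ F \<le> C\<close>[OF that] by (rule sqrt_le_D)
    have s: "(\<lambda>i. (cmod (x i))\<^sup>2 / w i) summable_on UNIV"
      using w F by (intro nonneg_bounded_partial_sums_imp_summable_on[where C = "C\<^sup>2"])
        (auto simp: less_imp_le intro!: eventually_finite_subsets_at_top_weakI)
    moreover have "(\<Sum>\<^sub>\<infinity>i. (cmod (x i))\<^sup>2 / w i) \<le> C\<^sup>2"
      using s F by (intro infsum_le_finite_sums) auto
    ultimately show ?thesis
      unfolding l2_norm_eq using C real_le_lsqrt by blast
  qed
  have diff: "(\<lambda>i. x i - y i) \<in> l2_space w" if "x \<in> l2_space w" "y \<in> l2_space w" for x y
  proof -
    have "sqrt (\<Sum>i\<in>F. (cmod (x i - y i))\<^sup>2 / w i) \<le> l2_norm w x + l2_norm w y"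
      if "finite F" for F
      using bd[of x y F "\<lambda>_. 0"] le[OF \<open>x \<in> _\<close> that] le[OF \<open>y \<in> _\<close> that]
      unfolding L2 by (simp add: norm_minus_commute)
    from *[OF this] show ?thesis by (simp add: l2_space_def)
  qed
  fix x y z assume x: "x \<in> l2_space w" and y: "y \<in> l2_space w"
  show "l2_dist w x y = 0 \<longleftrightarrow> x = y"
  proof
    assume "l2_dist w x y = 0"
    then have "x i = y i" for i
      using le[OF diff[OF x y], of "{i}"] w[of i] unfolding l2_dist_def
      by (simp add: divide_le_0_iff)
    then show "x = y" by auto
  qed (simp add: l2_dist_def l2_norm_eq)
  assume z: "z \<in> l2_space w"
  show "l2_dist w x z \<le> l2_dist w x y + l2_dist w y z"
  proof -
    have "sqrt (\<Sum>i\<in>F. (cmod (x i - z i))\<^sup>2 / w i) \<le> l2_dist w x y + l2_dist w y z"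
      if "finite F" for F
      using bd[of x z F y] le[OF diff[OF x y] that] le[OF diff[OF y z] that]
      unfolding L2 l2_dist_def by simp
    from *[OF this] show ?thesis by (simp add: l2_dist_def)
  qed
qed

end

theory Submission
  imports Defs
begin

text \<open>
  Reversibility gives \<open>\<pi>(i) P(i,j)\<^sup>2 = \<pi>(j) P(i,j) P(j,i)\<close>, and \<open>P(i,j) P(j,i)\<close> decays like
  \<open>q\<^sup>-\<^sup>j\<close>; hence the image of a ball lies in a box with square-summable sides, which is compact.

  The functions \<open>e\<^sub>k(i) = (q\<^sup>i - 1)(q\<^sup>i - q)\<cdots>(q\<^sup>i - q\<^bsup>k-1\<^esup>)\<close> satisfy
  \<open>P e\<^sub>k = q\<^bsup>-k\<^esup> e\<^sub>k + q\<^bsup>-m\<^esup> (1 - q\<^bsup>-k\<^esup>) e\<^bsub>k-1\<^esub>\<close>. Solving the resulting two-term recursion gives a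
  polynomial eigenfunction in \<open>q\<^sup>i\<close> for each \<open>q\<^bsup>-k\<^esup>\<close>. Conversely, an eigenvector \<open>\<mu>\<close> for any other
  eigenvalue annihilates every \<open>e\<^sub>k\<close>, hence every polynomial in \<open>q\<^sup>i\<close>. Since \<open>|\<mu>(i)|\<close> is bounded by
  a multiple of \<open>q\<^bsup>-i*i/2\<^esup>\<close>, suitable test polynomials force \<open>\<mu>(0) = 0\<close>, and the tridiagonal
  recurrence then gives \<open>\<mu> = 0\<close>.
\<close>

subsection \<open>Compact operators on weighted sequence spaces\<close>

lemma l2_space_summable_iff:
  assumes "\<And>i. w i > 0"
  shows "\<mu> \<in> l2_space w \<longleftrightarrow> summable (\<lambda>i. (cmod (\<mu> i))\<^sup>2 / w i)"
  unfolding l2_space_def using assms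
  by (simp add: summable_on_UNIV_nonneg_real_iff less_imp_le)

lemma l2_norm_suminf:
  assumes "\<And>i. w i > 0" "\<mu> \<in> l2_space w"
  shows "l2_norm w \<mu> = sqrt (\<Sum>i. (cmod (\<mu> i))\<^sup>2 / w i)"
  unfolding l2_norm_eq using assms(2) unfolding l2_space_def
  by (auto dest!: has_sum_imp_sums[OF has_sum_infsum] sums_unique)

lemma l2_norm_coordinate_le:
  assumes w: "\<And>i. w i > 0" and \<mu>: "\<mu> \<in> l2_space w"
  shows "(cmod (\<mu> i))\<^sup>2 \<le> (l2_norm w \<mu>)\<^sup>2 * w i"
proof -
  have nonneg: "0 \<le> (cmod (\<mu> j))\<^sup>2 / w j" for j
    using w by (simp add: less_imp_le)
  have s: "summable (\<lambda>i. (cmod (\<mu> i))\<^sup>2 / w i)"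
    using \<mu> w by (simp add: l2_space_summable_iff)
  have "(cmod (\<mu> i))\<^sup>2 / w i \<le> (\<Sum>i. (cmod (\<mu> i))\<^sup>2 / w i)"
    using sum_le_suminf[OF s, of "{i}"] nonneg by simp
  also have "\<dots> = (l2_norm w \<mu>)\<^sup>2"
    unfolding l2_norm_suminf[OF w \<mu>] using suminf_nonneg[OF s] nonneg by simp
  finally show ?thesis
    using w[of i] by (simp add: divide_le_eq)
qed

lemma l2_space_boxI:
  assumes w: "\<And>i. w i > 0" and b: "summable b"
    and le: "\<And>i. (cmod (\<mu> i))\<^sup>2 \<le> b i * w i"
  shows "\<mu> \<in> l2_space w"
  unfolding l2_space_summable_iff[OF w]
proof (rule summable_comparison_test'[OF b])
  show "norm ((cmod (\<mu> n))\<^sup>2 / w n) \<le> b n" for n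
    using w[of n] le[of n] by (simp add: divide_le_eq)
qed

text \<open>A box is a product of discs, hence compact for pointwise convergence by Tychonoff, and
  sequentially compact because that topology on sequences is metrizable. Domination by
  \<open>b\<close> then upgrades pointwise convergence to norm convergence through Tannery's
  theorem.\<close>

lemma compactin_l2_box:
  assumes w: "\<And>i. w i > 0" and b: "summable b"
  shows "compactin (Metric_space.mtopology (l2_space w) (l2_dist w))
    {\<mu>. \<forall>i. (cmod (\<mu> i))\<^sup>2 \<le> b i * w i}"
    (is "compactin _ ?K")
proof -
  interpret Metric_space "l2_space w" "l2_dist w"
    by (rule Metric_space_l2[OF w])
  have K: "?K \<subseteq> l2_space w"
    using l2_space_boxI[OF w b] by auto
  have K_eq: "?K = PiE UNIV (\<lambda>i. {z. (cmod z)\<^sup>2 \<le> b i * w i})"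
    by (auto simp: PiE_def Pi_def)
  have ball: "compact {z. (cmod z)\<^sup>2 \<le> c}" for c
  proof (cases "c \<ge> 0")
    case True
    then have "{z. (cmod z)\<^sup>2 \<le> c} = cball 0 (sqrt c)"
      using power_mono[of "cmod _" "sqrt c" 2] by (auto simp: real_le_rsqrt)
    then show ?thesis by simp
  next
    case False
    then have "{z. (cmod z)\<^sup>2 \<le> c} = {}"
      using zero_le_power2 by (auto simp: not_le intro: less_le_trans)
    then show ?thesis by simp
  qed
  have "compactin (product_topology (\<lambda>i. euclidean) UNIV) ?K"
    unfolding K_eq compactin_PiE using ball by auto
  then have "compact ?K"
    unfolding euclidean_product_topology by simp
  then have seq: "seq_compact ?K"
    using compact_eq_seq_compact_metric by blast
  show ?thesis
    unfolding compactin_sequentially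
  proof (intro conjI allI impI)
    show "?K \<subseteq> l2_space w" by (rule K)
    fix \<sigma> :: "nat \<Rightarrow> nat \<Rightarrow> complex"
    assume "range \<sigma> \<subseteq> ?K"
    then have \<sigma>: "\<sigma> n \<in> ?K" for n by auto
    have "\<exists>l\<in>?K. \<exists>r. strict_mono r \<and> (\<sigma> \<circ> r) \<longlonglongrightarrow> l"
      by (rule seq[unfolded seq_compact_def, rule_format]) (rule \<sigma>)
    then obtain l r where l: "l \<in> ?K" and r: "strict_mono r" and lim: "(\<sigma> \<circ> r) \<longlonglongrightarrow> l"
      by blast
    have pt: "(\<lambda>n. \<sigma> (r n) i) \<longlonglongrightarrow> l i" for i
    proof -
      have c: "continuous_on UNIV (\<lambda>x::nat \<Rightarrow> complex. x i)"
        by (rule continuous_on_product_then_coordinatewise) (rule continuous_on_id)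
      show ?thesis
        using continuous_on_tendsto_compose[OF c lim] by (simp add: o_def)
    qed
    define a where "a i n = (cmod (\<sigma> (r n) i - l i))\<^sup>2 / w i" for i n
    \<comment> \<open>Both points lie in the box, and |x - y|^2 is at most 2|x|^2 + 2|y|^2; this
      gives the dominating series \<open>4 * b i\<close>.\<close>
    have a_le: "norm (a i n) \<le> 4 * b i" for i n
    proof -
      have "(cmod (\<sigma> (r n) i - l i))\<^sup>2 \<le> (cmod (\<sigma> (r n) i) + cmod (l i))\<^sup>2"
        by (intro power_mono norm_triangle_ineq4) auto
      also have "\<dots> \<le> 2 * (cmod (\<sigma> (r n) i))\<^sup>2 + 2 * (cmod (l i))\<^sup>2"
        using sum_squares_bound[of "cmod (\<sigma> (r n) i)" "cmod (l i)"] by (simp add: power2_sum)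
      also have "\<dots> \<le> 2 * (b i * w i) + 2 * (b i * w i)"
        using \<sigma>[of "r n"] l by (intro add_mono mult_left_mono) auto
      finally show ?thesis
        using w[of i] by (simp add: a_def divide_le_eq)
    qed
    have "((\<lambda>n. \<Sum>i. a i n) \<longlonglongrightarrow> (\<Sum>i. 0))"
    proof -
      have "(\<lambda>n. a i n) \<longlonglongrightarrow> 0" for i
      proof -
        have "(\<lambda>n. a i n) \<longlonglongrightarrow> (cmod (l i - l i))\<^sup>2 / w i"
          unfolding a_def using w[of i] by (intro tendsto_intros pt) simp
        then show ?thesis by simp
      qed
      then show ?thesis
        using a_le b by (intro tannerys_theorem[where M = "\<lambda>i. 4 * b i", THEN conjunct2, THEN conjunct2])
          (auto intro!: summable_mult simp: case_prod_unfold)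
    qed
    then have "(\<lambda>n. sqrt (\<Sum>i. a i n)) \<longlonglongrightarrow> sqrt 0"
      by (intro tendsto_real_sqrt) simp
    moreover have "l2_dist w ((\<sigma> \<circ> r) n) l = sqrt (\<Sum>i. a i n)" for n
    proof -
      have "(cmod (\<sigma> (r n) i - l i))\<^sup>2 \<le> 4 * b i * w i" for i
        using a_le[of i n] w[of i] by (simp add: a_def divide_le_eq)
      then have "(\<lambda>i. \<sigma> (r n) i - l i) \<in> l2_space w"
        using b by (intro l2_space_boxI[OF w, where b = "\<lambda>i. 4 * b i"] summable_mult) auto
      then show ?thesis
        by (simp add: l2_dist_def l2_norm_suminf[OF w] a_def)
    qed
    moreover have "l \<in> l2_space w" "\<sigma> n \<in> l2_space w" for n
      using l \<sigma> K by blast+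
    ultimately have "limitin mtopology (\<sigma> \<circ> r) l sequentially"
      unfolding limitin_metric_dist_null by simp
    then show "\<exists>l r. l \<in> ?K \<and> strict_mono r \<and> limitin mtopology (\<sigma> \<circ> r) l sequentially"
      using l r by blast
  qed
qed

text \<open>A bounded set lies in a ball of some radius \<open>R\<close> about 0, so its image lies
  in the box with sides scaled by \<open>R\<close>. That box is compact, hence closed in a metric
  space, so it contains the closure of the image.\<close>

lemma l2_compact_operatorI:
  assumes w: "\<And>i. w i > 0" and b: "summable b" and lin: "l2_linear w T"
    and bound: "\<And>\<mu> i. \<mu> \<in> l2_space w \<Longrightarrow> (cmod (T \<mu> i))\<^sup>2 \<le> (l2_norm w \<mu>)\<^sup>2 * (b i * w i)"
    and b0: "\<And>i. b i \<ge> 0"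
  shows "l2_compact_operator w T"
  unfolding l2_compact_operator_def
proof (intro conjI allI impI lin)
  interpret Metric_space "l2_space w" "l2_dist w"
    by (rule Metric_space_l2[OF w])
  fix B assume B: "mbounded B"
  have zero: "(\<lambda>i. 0) \<in> l2_space w"
    by (simp add: l2_space_def)
  obtain y r where y: "B \<subseteq> mcball y r"
    using B unfolding mbounded_def by blast
  define R where "R = l2_dist w (\<lambda>i. 0) y + r"
  have R: "B \<subseteq> mcball (\<lambda>i. 0) R"
  proof
    fix x assume "x \<in> B"
    then have "x \<in> l2_space w" "y \<in> l2_space w" "l2_dist w y x \<le> r"
      using y by auto
    with triangle[OF zero, of y x] zero show "x \<in> mcball (\<lambda>i. 0) R"
      by (simp add: R_def)
  qed
  let ?K = "{\<mu>. \<forall>i. (cmod (\<mu> i))\<^sup>2 \<le> (R\<^sup>2 * b i) * w i}"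
  have "T ` B \<subseteq> ?K"
  proof (clarify)
    fix \<mu> i assume "\<mu> \<in> B"
    with R have \<mu>: "\<mu> \<in> l2_space w" and "l2_dist w (\<lambda>i. 0) \<mu> \<le> R"
      by auto
    then have n: "l2_norm w \<mu> \<le> R"
      by (simp add: l2_dist_def l2_norm_eq)
    have "0 \<le> l2_norm w \<mu>"
      unfolding l2_norm_eq using w by (auto intro!: infsum_nonneg simp: less_imp_le)
    then have "(l2_norm w \<mu>)\<^sup>2 * (b i * w i) \<le> R\<^sup>2 * (b i * w i)"
      using n b0 w by (intro mult_right_mono power_mono) (auto simp: less_imp_le)
    with bound[OF \<mu>, of i] show "(cmod (T \<mu> i))\<^sup>2 \<le> R\<^sup>2 * b i * w i"
      by (simp add: mult.assoc)
  qed
  moreover have K: "compactin mtopology ?K"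
    using b by (intro compactin_l2_box w summable_mult)
  ultimately have "mtopology closure_of (T ` B) \<subseteq> ?K"
    by (intro closure_of_minimal compactin_imp_closedin Hausdorff_space_mtopology)
  with K show "compactin mtopology (mtopology closure_of (T ` B))"
    by (rule closed_compactin) simp
qed


subsection \<open>Gaussian decay against geometric growth\<close>

text \<open>Growth class containing all polynomials in \<open>q ^ i\<close>. It is stable under
  sums, products and index shifts, and Gaussian decay makes any member summable.\<close>

definition geom_bounded :: "real \<Rightarrow> (nat \<Rightarrow> real) \<Rightarrow> bool" where
  "geom_bounded q g \<longleftrightarrow> (\<exists>G n. 0 \<le> G \<and> (\<forall>i. \<bar>g i\<bar> \<le> G * q ^ (n * i)))"

lemma geom_bounded_const: "geom_bounded q (\<lambda>i. c)"
  unfolding geom_bounded_def by (intro exI[of _ "\<bar>c\<bar>"] exI[of _ 0]) simp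

lemma geom_bounded_mult:
  assumes "geom_bounded q f" "geom_bounded q g"
  shows "geom_bounded q (\<lambda>i. f i * g i)"
proof -
  obtain F n where F: "0 \<le> F" "\<And>i. \<bar>f i\<bar> \<le> F * q ^ (n * i)"
    using assms(1) unfolding geom_bounded_def by blast
  obtain G k where G: "0 \<le> G" "\<And>i. \<bar>g i\<bar> \<le> G * q ^ (k * i)"
    using assms(2) unfolding geom_bounded_def by blast
  have "\<bar>f i * g i\<bar> \<le> (F * G) * q ^ ((n + k) * i)" for i
    using mult_mono[OF F(2)[of i] G(2)[of i]] abs_ge_zero[of "f i"] F(2)[of i]
    by (simp add: abs_mult algebra_simps power_add)
  then show ?thesis
    unfolding geom_bounded_def using F(1) G(1)
    by (intro exI[of _ "F * G"] exI[of _ "n + k"]) auto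
qed

lemma geom_bounded_add:
  assumes q: "1 \<le> q" and "geom_bounded q f" "geom_bounded q g"
  shows "geom_bounded q (\<lambda>i. f i + g i)"
proof -
  obtain F n where F: "0 \<le> F" "\<And>i. \<bar>f i\<bar> \<le> F * q ^ (n * i)"
    using assms(2) unfolding geom_bounded_def by blast
  obtain G k where G: "0 \<le> G" "\<And>i. \<bar>g i\<bar> \<le> G * q ^ (k * i)"
    using assms(3) unfolding geom_bounded_def by blast
  have "\<bar>f i + g i\<bar> \<le> (F + G) * q ^ ((n + k) * i)" for i
  proof -
    have "\<bar>f i + g i\<bar> \<le> F * q ^ (n * i) + G * q ^ (k * i)"
      using F(2)[of i] G(2)[of i] by linarith
    also have "\<dots> \<le> F * q ^ ((n + k) * i) + G * q ^ ((n + k) * i)"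
      using F(1) G(1) q by (intro add_mono mult_left_mono power_increasing) auto
    finally show ?thesis by (simp add: algebra_simps)
  qed
  then show ?thesis
    unfolding geom_bounded_def using F(1) G(1)
    by (intro exI[of _ "F + G"] exI[of _ "n + k"]) auto
qed

lemma geom_bounded_sum:
  assumes "1 \<le> q" "\<And>k. k \<in> A \<Longrightarrow> geom_bounded q (f k)"
  shows "geom_bounded q (\<lambda>i. \<Sum>k\<in>A. f k i)"
  using assms(2)
  by (induction A rule: infinite_finite_induct)
    (auto intro: geom_bounded_add assms(1) geom_bounded_const)

lemma geom_bounded_prod:
  assumes "\<And>k. k \<in> A \<Longrightarrow> geom_bounded q (f k)"
  shows "geom_bounded q (\<lambda>i. \<Prod>k\<in>A. f k i)"
  using assms
  by (induction A rule: infinite_finite_induct)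
    (auto intro: geom_bounded_mult geom_bounded_const)

lemma geom_bounded_power_diff:
  assumes "1 \<le> q"
  shows "geom_bounded q (\<lambda>i. q ^ i - a)"
proof -
  have "\<bar>q ^ i\<bar> \<le> 1 * q ^ (1 * i)" for i
    using assms by simp
  then have "geom_bounded q (\<lambda>i. q ^ i)"
    unfolding geom_bounded_def by (meson zero_le_one)
  from geom_bounded_add[OF assms this geom_bounded_const[of q "-a"]] show ?thesis
    by simp
qed

lemma geom_bounded_Suc:
  assumes "1 \<le> q" "geom_bounded q f"
  shows "geom_bounded q (\<lambda>i. f (Suc i))"
proof -
  obtain F n where F: "0 \<le> F" "\<And>i. \<bar>f i\<bar> \<le> F * q ^ (n * i)"
    using assms(2) unfolding geom_bounded_def by blast
  have "\<bar>f (Suc i)\<bar> \<le> (F * q ^ n) * q ^ (n * i)" for i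
    using F(2)[of "Suc i"] by (simp add: power_add mult.assoc)
  then show ?thesis
    unfolding geom_bounded_def using F(1) assms(1)
    by (intro exI[of _ "F * q ^ n"] exI[of _ n]) auto
qed

lemma geom_bounded_pred:
  assumes "1 \<le> q" "geom_bounded q f"
  shows "geom_bounded q (\<lambda>i. f (i - 1))"
proof -
  obtain F n where F: "0 \<le> F" "\<And>i. \<bar>f i\<bar> \<le> F * q ^ (n * i)"
    using assms(2) unfolding geom_bounded_def by blast
  have "\<bar>f (i - 1)\<bar> \<le> F * q ^ (n * i)" for i
    using F(2)[of "i - 1"] F(1) assms(1)
    by (elim order_trans) (intro mult_left_mono power_increasing, auto)
  then show ?thesis
    unfolding geom_bounded_def using F(1) by blast
qed

text \<open>The growth \<open>s ^ (2 * n * i)\<close> competes with \<open>s ^ (i * i)\<close>. Once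
  \<open>i\<close> reaches \<open>2 * n + 1\<close>, the exponent \<open>i * i\<close> exceeds
  \<open>2 * n * i\<close> by at least \<open>i\<close>, which leaves a geometric series of ratio
  \<open>1 / s\<close>.\<close>

lemma summable_gaussian_geom_bounded:
  fixes \<mu> :: "nat \<Rightarrow> complex"
  assumes s: "1 < s" and \<mu>: "\<And>i. cmod (\<mu> i) \<le> C / s ^ (i * i)"
    and g: "geom_bounded (s\<^sup>2) g"
  shows "summable (\<lambda>i. \<mu> i * of_real (g i))"
proof -
  obtain G n where G: "0 \<le> G" "\<And>i. \<bar>g i\<bar> \<le> G * s\<^sup>2 ^ (n * i)"
    using g unfolding geom_bounded_def by blast
  have C: "0 \<le> C"
    using order_trans[OF norm_ge_zero \<mu>[of 0]] by simp
  show ?thesis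
  proof (rule summable_comparison_test'[where g = "\<lambda>i. C * G * (1 / s) ^ i" and N = "2 * n + 1"])
    show "summable (\<lambda>i. C * G * (1 / s) ^ i)"
      using s by (intro summable_mult summable_geometric) simp
    fix i assume i: "2 * n + 1 \<le> i"
    have "norm (\<mu> i * of_real (g i)) \<le> (C / s ^ (i * i)) * (G * s\<^sup>2 ^ (n * i))"
      unfolding norm_mult norm_of_real using \<mu> G C s by (intro mult_mono) auto
    also have "\<dots> = C * G * (s ^ (2 * n * i) / s ^ (i * i))"
      by (simp add: power_mult[symmetric] mult.assoc)
    also have "s ^ (2 * n * i) / s ^ (i * i) \<le> (1 / s) ^ i"
    proof -
      have "s ^ (2 * n * i) * s ^ i \<le> s ^ (i * i)"
        unfolding power_add[symmetric] using s mult_le_mono1[OF i, of i]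
        by (intro power_increasing) (auto simp: algebra_simps)
      then show ?thesis
        using s by (simp add: field_simps)
    qed
    finally show "norm (\<mu> i * of_real (g i)) \<le> C * G * (1 / s) ^ i"
      using C G(1) by (simp add: mult_left_mono)
  qed
qed

text \<open>Completing the square: for \<open>i = r + Suc N\<close>,
  \<open>2 * N * i - i * i\<close> equals \<open>N * N - (r + 1)^2\<close>, which is at most
  \<open>N * N - r\<close>. A geometric series in \<open>r\<close> remains.\<close>

lemma suminf_gaussian_tail_le:
  fixes C s :: real
  assumes s: "1 < s" and C: "0 \<le> C"
    and f: "\<And>i. i > N \<Longrightarrow> cmod (f i) \<le> C / s ^ (i * i) * s ^ (2 * N * i)"
  shows "cmod (\<Sum>r. f (r + Suc N)) \<le> C * s ^ (N * N) * (1 / (1 - 1 / s))"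
proof -
  have le: "norm (f (r + Suc N)) \<le> C * s ^ (N * N) * (1 / s) ^ r" for r
  proof -
    let ?i = "r + Suc N"
    have "s ^ (2 * N * ?i) * s ^ r \<le> s ^ (N * N) * s ^ (?i * ?i)"
      unfolding power_add[symmetric] using s
      by (intro power_increasing) (auto simp: algebra_simps)
    then have "s ^ (2 * N * ?i) / s ^ (?i * ?i) \<le> s ^ (N * N) * (1 / s) ^ r"
      using s by (simp add: field_simps)
    then have "C * (s ^ (2 * N * ?i) / s ^ (?i * ?i)) \<le> C * (s ^ (N * N) * (1 / s) ^ r)"
      using C by (rule mult_left_mono)
    with f[of ?i] show ?thesis by (simp add: mult.assoc)
  qed
  have g: "summable (\<lambda>r. C * s ^ (N * N) * (1 / s) ^ r)"
    using s by (intro summable_mult summable_geometric) simp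
  have "cmod (\<Sum>r. f (r + Suc N)) \<le> (\<Sum>r. C * s ^ (N * N) * (1 / s) ^ r)"
    by (rule norm_suminf_le[OF le g])
  also have "\<dots> = C * s ^ (N * N) * (1 / (1 - 1 / s))"
    using s by (simp add: suminf_mult suminf_geometric summable_geometric)
  finally show ?thesis .
qed

text \<open>A coordinate is at most the norm times the square root of the weight. The square root
  halves the Gaussian exponent, which is why the weight is measured in powers of \<open>s^2\<close>
  and the sequence in powers of \<open>s\<close>.\<close>

lemma l2_space_gaussian_bound:
  assumes s: "1 < s" and w: "\<And>i. 0 < w i" and wC: "\<And>i. w i \<le> C / s\<^sup>2 ^ (i * i)"
    and \<mu>: "\<mu> \<in> l2_space w"
  obtains D where "\<And>i. cmod (\<mu> i) \<le> D / s ^ (i * i)"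
proof
  fix i
  have "(cmod (\<mu> i))\<^sup>2 \<le> (l2_norm w \<mu>)\<^sup>2 * (C / s\<^sup>2 ^ (i * i))"
    using l2_norm_coordinate_le[OF w \<mu>, of i] mult_left_mono[OF wC[of i], of "(l2_norm w \<mu>)\<^sup>2"]
    by simp
  also have "\<dots> = (l2_norm w \<mu>)\<^sup>2 * C / (s ^ (i * i))\<^sup>2"
    by (simp add: power_mult[symmetric] mult.commute)
  finally have "cmod (\<mu> i) \<le> sqrt ((l2_norm w \<mu>)\<^sup>2 * C / (s ^ (i * i))\<^sup>2)"
    by (rule real_le_rsqrt)
  also have "\<dots> = sqrt ((l2_norm w \<mu>)\<^sup>2 * C) / s ^ (i * i)"
    using s by (simp add: real_sqrt_divide)
  finally show "cmod (\<mu> i) \<le> sqrt ((l2_norm w \<mu>)\<^sup>2 * C) / s ^ (i * i)" .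
qed


subsection \<open>The chain, its stationary weight and compactness\<close>

lemma eta_enat: "eta q (enat n) = (\<Prod>j<n. 1 - 1 / q ^ Suc j)"
proof -
  have "eta q (enat n) = (\<Prod>j=1..n. 1 - 1 / q ^ j)"
    by (simp add: eta_def power_int_minus_divide)
  also have "\<dots> = (\<Prod>j<n. 1 - 1 / q ^ Suc j)"
    by (rule prod.reindex_bij_witness[of _ Suc "\<lambda>j. j - 1"]) auto
  finally show ?thesis .
qed

lemma eta_infinity: "eta q \<infinity> = (\<Prod>j. 1 - 1 / q ^ Suc j)"
  by (simp add: eta_def power_int_minus_divide del: power_Suc of_nat_Suc)

locale corank_chain =
  fixes q :: real and m :: nat
  assumes q_gt1: "1 < q"
begin

abbreviation P :: "nat \<Rightarrow> nat \<Rightarrow> real" where "P \<equiv> P_matrix q m"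
abbreviation w :: "nat \<Rightarrow> real" where "w \<equiv> pi_dist q m"

text \<open>The three transition probabilities are rewritten with reciprocals of natural powers,
  avoiding negative integer exponents.\<close>

definition up :: "nat \<Rightarrow> real" where "up i = 1 / q ^ (2 * i + m + 1)"
definition down :: "nat \<Rightarrow> real" where "down i = (1 - 1 / q ^ i) * (1 - 1 / q ^ (m + i))"
definition stay :: "nat \<Rightarrow> real" where "stay i = 1 - down i - up i"

lemma q_pos: "0 < q" and q_ge1: "1 \<le> q" and q_nz: "q \<noteq> 0"
  using q_gt1 by auto

lemma power_factor_pos: "0 < 1 - 1 / q ^ Suc j"
  using one_less_power[OF q_gt1, of "Suc j"] by simp

lemma down_0 [simp]: "down 0 = 0"
  by (simp add: down_def)

lemma down_Suc_pos: "0 < down (Suc i)"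
  using power_factor_pos[of i] power_factor_pos[of "m + i"] by (simp add: down_def)

lemma down_nonneg: "0 \<le> down i"
  by (cases i) (auto intro: less_imp_le down_Suc_pos)

lemma down_le_1: "down i \<le> 1"
  unfolding down_def using q_ge1 by (intro mult_le_one) auto

lemma up_pos: "0 < up i"
  using q_pos by (simp add: up_def)

lemma up_le: "up i \<le> 1 / q ^ i" "up i \<le> 1 / q ^ Suc i" "up i \<le> 1"
proof -
  show "up i \<le> 1 / q ^ i" "up i \<le> 1 / q ^ Suc i"
    unfolding up_def using q_gt1 by (intro divide_left_mono power_increasing; force)+
  show "up i \<le> 1"
    unfolding up_def using one_le_power[OF q_ge1] q_pos by (simp del: power_Suc add_Suc_right)
qed

text \<open>The constant 1 cancels the leading term of \<open>down i\<close>, so everything left is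
  of order \<open>1 / q ^ i\<close>. Compactness needs this decay on the diagonal.\<close>

lemma stay_abs_le: "\<bar>stay i\<bar> \<le> 2 / q ^ i"
proof -
  define a v where "a = 1 / q ^ i" and "v = 1 / q ^ m"
  have a: "0 \<le> a" "a \<le> 1" and v: "0 \<le> v" "v \<le> 1"
    using q_gt1 by (auto simp: a_def v_def)
  have eq: "stay i = a + v * a - v * a * a - up i"
  proof -
    have "down i = (1 - a) * (1 - v * a)"
      by (simp add: down_def a_def v_def power_add)
    then show ?thesis by (simp add: stay_def algebra_simps)
  qed
  have "v * a \<le> a" "v * a * a \<le> v * a" "0 \<le> v * a * a" "0 \<le> v * a"
    using a v mult_right_mono[of v 1 a] mult_left_mono[of a 1 "v * a"] by auto
  moreover have "0 \<le> up i" "up i \<le> a"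
    using up_pos[of i] up_le(1)[of i] by (auto simp: a_def)
  moreover have "2 / q ^ i = 2 * a"
    by (simp add: a_def)
  ultimately show ?thesis
    unfolding eq by linarith
qed

lemma P_eq:
  "P i (Suc i) = up i" "P i i = stay i" "P (Suc i) i = down (Suc i)"
  "j \<noteq> i \<Longrightarrow> j \<noteq> Suc i \<Longrightarrow> i \<noteq> Suc j \<Longrightarrow> P i j = 0"
proof -
  have up: "q powi (- 1 - 2 * int i - int m) = up i" for i
  proof -
    have "- 1 - 2 * int i - int m = - int (2 * i + m + 1)" by simp
    then show ?thesis unfolding up_def by (simp only: power_int_minus_divide power_int_of_nat)
  qed
  have minus: "q powi (- int i) = 1 / q ^ i" for i
    by (simp add: power_int_minus_divide)
  have minus2: "q powi (- int m - int i) = 1 / q ^ (m + i)" for i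
    using minus[of "m + i"] by simp
  show "P i (Suc i) = up i" "P i i = stay i" "P (Suc i) i = down (Suc i)"
    unfolding P_matrix_def up minus minus2 by (auto simp: stay_def down_def)
  show "j \<noteq> i \<Longrightarrow> j \<noteq> Suc i \<Longrightarrow> i \<noteq> Suc j \<Longrightarrow> P i j = 0"
    unfolding P_matrix_def by auto
qed

text \<open>Each column of \<open>P\<close> has finitely many nonzero entries, so this formula and
  the next hold for arbitrary sequences.\<close>

lemma matrix_action_P_0:
  "matrix_action P \<mu> 0 = \<mu> 0 * of_real (stay 0) + \<mu> 1 * of_real (down 1)"
proof -
  have "matrix_action P \<mu> 0 = (\<Sum>\<^sub>\<infinity>i\<in>{0, 1}. \<mu> i * of_real (P i 0))"
    unfolding matrix_action_def by (rule infsum_cong_neutral) (auto simp: P_eq)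
  then show ?thesis by (simp add: P_eq)
qed

lemma matrix_action_P_Suc:
  "matrix_action P \<mu> (Suc j) = \<mu> j * of_real (up j) + \<mu> (Suc j) * of_real (stay (Suc j))
    + \<mu> (Suc (Suc j)) * of_real (down (Suc (Suc j)))"
proof -
  have "matrix_action P \<mu> (Suc j) = (\<Sum>\<^sub>\<infinity>i\<in>{j, Suc j, Suc (Suc j)}. \<mu> i * of_real (P i (Suc j)))"
    unfolding matrix_action_def by (rule infsum_cong_neutral) (auto simp: P_eq)
  then show ?thesis by (simp add: P_eq)
qed

section \<open>Infinite product, stationary weight and detailed balance\<close>

lemma eta_pos: "0 < eta q (enat n)"
  unfolding eta_enat using power_factor_pos by (intro prod_pos) auto

text \<open>The factors differ from 1 by a geometric sequence, so the product converges absolutely;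
  as no factor vanishes, neither does the limit.\<close>

lemma eta_tendsto: "(\<lambda>n. eta q (enat n)) \<longlonglongrightarrow> eta q \<infinity>"
  and eta_infinity_nonzero: "eta q \<infinity> \<noteq> 0"
proof -
  have "summable (\<lambda>j. (1 / q) * (1 / q) ^ j)"
    using q_gt1 by (intro summable_mult summable_geometric) simp
  then have "summable (\<lambda>j. norm ((1 - 1 / q ^ Suc j) - 1))"
    using q_pos by (simp add: power_divide)
  then have conv: "convergent_prod (\<lambda>j. 1 - 1 / q ^ Suc j)"
    using abs_convergent_prod_conv_summable abs_convergent_prod_imp_convergent_prod by blast
  have "(\<lambda>n. eta q (enat (Suc n))) \<longlonglongrightarrow> eta q \<infinity>"
    using convergent_prod_LIMSEQ[OF conv] by (simp only: eta_enat eta_infinity lessThan_Suc_atMost)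
  then show "(\<lambda>n. eta q (enat n)) \<longlonglongrightarrow> eta q \<infinity>"
    by (rule LIMSEQ_imp_Suc)
  show "eta q \<infinity> \<noteq> 0"
    unfolding eta_infinity using power_factor_pos by (intro prodinf_nonzero conv) (metis less_irrefl)
qed

lemma eta_infinity_pos: "0 < eta q \<infinity>"
  using LIMSEQ_le_const[OF eta_tendsto] eta_pos eta_infinity_nonzero
  by (metis less_imp_le order_le_less)

lemma eta_infinity_le: "eta q \<infinity> \<le> eta q (enat n)"
proof -
  have "decseq (\<lambda>n. eta q (enat n))"
  proof (rule decseq_SucI)
    show "eta q (enat (Suc n)) \<le> eta q (enat n)" for n
      using eta_pos[of n] power_factor_pos[of n] q_pos
      by (simp add: eta_enat mult_left_le del: power_Suc)
  qed
  then show ?thesis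
    using eta_tendsto by (rule decseq_ge)
qed

lemma w_pos: "0 < w i"
  using eta_infinity_pos eta_pos q_pos by (simp add: pi_dist_def)

text \<open>Both finite products in the denominator are at least their common limit; one copy of the
  limit cancels the numerator.\<close>

lemma w_le: "w i \<le> (1 / eta q \<infinity>) / q ^ (i * i)"
proof -
  let ?e = "eta q \<infinity>"
  have "w i \<le> ?e / (q ^ (i * i) * ?e * ?e)"
    unfolding pi_dist_def using eta_infinity_pos eta_infinity_le eta_pos q_gt1
    by (intro divide_left_mono mult_mono power_increasing mult_pos_pos)
      (auto simp: less_imp_le algebra_simps)
  then show ?thesis
    using eta_infinity_pos by (simp add: field_simps)
qed

text \<open>Passing from \<open>i\<close> to \<open>Suc i\<close> raises the exponent of
  \<open>q\<close> by \<open>2 * i + m + 1\<close>, matching \<open>up i\<close>, and adds one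
  factor to each finite product, matching the two factors of \<open>down (Suc i)\<close>.\<close>

lemma detailed_balance: "w i * up i = w (Suc i) * down (Suc i)"
proof -
  let ?f = "1 - 1 / q ^ Suc i" and ?g = "1 - 1 / q ^ Suc (m + i)"
  have fg: "?f \<noteq> 0" "?g \<noteq> 0"
    using power_factor_pos by (metis less_irrefl)+
  have cancel: "E / (A * e * g) * (1 / B) = E / (A * B * (e * f) * (g * h)) * (f * h)"
    if "f \<noteq> 0" "h \<noteq> 0" for A B E e f g h :: real
    using that by simp
  have "w (Suc i) = eta q \<infinity> / (q ^ (Suc i * (Suc i + m))
      * (eta q (enat i) * ?f) * (eta q (enat (i + m)) * ?g))"
    by (simp add: pi_dist_def eta_enat add.commute)
  moreover have "q ^ (Suc i * (Suc i + m)) = q ^ (i * (i + m)) * q ^ (2 * i + m + 1)"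
  proof -
    have "Suc i * (Suc i + m) = i * (i + m) + (2 * i + m + 1)" by (simp add: algebra_simps)
    then show ?thesis by (simp only: power_add)
  qed
  moreover have "down (Suc i) = ?f * ?g"
    by (simp add: down_def)
  ultimately show ?thesis
    by (simp only: pi_dist_def up_def cancel[OF fg])
qed

section \<open>Coordinate bounds and compactness of the operator\<close>

lemma matrix_action_P_bound:
  assumes "\<mu> \<in> l2_space w"
  shows "(cmod (matrix_action P \<mu> j))\<^sup>2 \<le> (l2_norm w \<mu>)\<^sup>2 * (36 / q ^ j * w j)"
proof -
  let ?N = "(l2_norm w \<mu>)\<^sup>2"
  have coord: "(cmod (\<mu> i * of_real r))\<^sup>2 \<le> ?N * (w i * r\<^sup>2)" for i r
    using mult_right_mono[OF l2_norm_coordinate_le[OF w_pos assms, of i], of "r\<^sup>2"]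
    by (simp add: norm_mult power_mult_distrib mult.assoc)
  have bound: "(cmod (\<mu> i * of_real r))\<^sup>2 \<le> ?N * (4 / q ^ j * w j)"
    if "w i * r\<^sup>2 \<le> 4 / q ^ j * w j" for i r
    using coord[of i r] mult_left_mono[OF that, of ?N] by simp
  \<comment> \<open>Reversibility gives nothing on the diagonal; the entry itself is small there,
    and one of its two powers of \<open>1 / q ^ j\<close> suffices.\<close>
  have stay: "(cmod (\<mu> j * of_real (stay j)))\<^sup>2 \<le> ?N * (4 / q ^ j * w j)"
  proof (rule bound)
    have "(stay j)\<^sup>2 \<le> (2 / q ^ j)\<^sup>2"
      using stay_abs_le[of j] by (metis abs_ge_zero power2_abs power_mono)
    also have "\<dots> = 4 / q ^ j * (1 / q ^ j)"
      by (simp add: power2_eq_square)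
    also have "\<dots> \<le> 4 / q ^ j * 1"
      using q_gt1 by (intro mult_left_mono) auto
    finally have "w j * (stay j)\<^sup>2 \<le> w j * (4 / q ^ j * 1)"
      using w_pos[of j] by (intro mult_left_mono) auto
    then show "w j * (stay j)\<^sup>2 \<le> 4 / q ^ j * w j"
      by (simp add: mult.commute)
  qed
  \<comment> \<open>Detailed balance trades one \<open>down\<close> for \<open>up j\<close>, which
    supplies the decay.\<close>
  have down: "(cmod (\<mu> (Suc j) * of_real (down (Suc j))))\<^sup>2 \<le> ?N * (4 / q ^ j * w j)"
  proof (rule bound)
    have "w (Suc j) * (down (Suc j))\<^sup>2 = w j * (up j * down (Suc j))"
      using detailed_balance[of j] by (simp add: power2_eq_square mult.assoc[symmetric])
    also have "\<dots> \<le> w j * ((1 / q ^ j) * 1)"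
      using w_pos[of j] up_le(1)[of j] up_pos[of j] down_nonneg down_le_1 q_pos
      by (intro mult_left_mono mult_mono) auto
    also have "\<dots> \<le> 4 / q ^ j * w j"
      using w_pos[of j] q_pos by (simp add: divide_right_mono)
    finally show "w (Suc j) * (down (Suc j))\<^sup>2 \<le> 4 / q ^ j * w j" .
  qed
  \<comment> \<open>The source is \<open>i = j - 1\<close>, so the sharper bound
    \<open>1 / q ^ Suc i\<close> on \<open>up i\<close> is what yields
    \<open>1 / q ^ j\<close>.\<close>
  have up: "(cmod (\<mu> i * of_real (up i)))\<^sup>2 \<le> ?N * (4 / q ^ j * w j)" if j: "j = Suc i" for i
  proof (rule bound)
    have "w i * (up i)\<^sup>2 = up i * (w i * up i)"
      by (simp add: power2_eq_square)
    also have "\<dots> = w j * (up i * down j)"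
      by (simp add: detailed_balance j)
    also have "\<dots> \<le> w j * ((1 / q ^ j) * 1)"
      using w_pos[of j] up_le(2)[of i] up_pos[of i] down_nonneg down_le_1 q_pos
      by (intro mult_left_mono mult_mono) (auto simp: j)
    also have "\<dots> \<le> 4 / q ^ j * w j"
      using w_pos[of j] q_pos by (simp add: divide_right_mono)
    finally show "w i * (up i)\<^sup>2 \<le> 4 / q ^ j * w j" .
  qed
  \<comment> \<open>The square of a sum of three is at most 3 times the sum of squares, hence the
    factor 9; with the 4 above this makes 36.\<close>
  have three: "(cmod (x + y + z))\<^sup>2 \<le> 9 * K"
    if "(cmod x)\<^sup>2 \<le> K" "(cmod y)\<^sup>2 \<le> K" "(cmod z)\<^sup>2 \<le> K" for x y z K
  proof -
    have "(cmod (x + y + z))\<^sup>2 \<le> (cmod x + cmod y + cmod z)\<^sup>2"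
      by (intro power_mono order_trans[OF norm_triangle_ineq] add_right_mono norm_triangle_ineq) auto
    also have "\<dots> \<le> 3 * (cmod x)\<^sup>2 + 3 * (cmod y)\<^sup>2 + 3 * (cmod z)\<^sup>2"
      using sum_squares_bound[of "cmod x" "cmod y"] sum_squares_bound[of "cmod x" "cmod z"]
        sum_squares_bound[of "cmod y" "cmod z"] by (simp add: power2_eq_square algebra_simps)
    finally show ?thesis using that by simp
  qed
  have eq: "9 * (?N * (4 / q ^ j * w j)) = ?N * (36 / q ^ j * w j)"
    by simp
  show ?thesis
  proof (cases j)
    case 0
    have "0 \<le> ?N * (4 / q ^ j * w j)"
      using w_pos[of j] q_pos by simp
    then show ?thesis
      using three[OF stay down, of 0] unfolding eq by (simp add: 0 matrix_action_P_0)
  next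
    case (Suc i)
    show ?thesis
      using three[OF up[OF Suc] stay down, unfolded eq] unfolding Suc matrix_action_P_Suc .
  qed
qed


lemma l2_linear_P: "l2_linear w (matrix_action P)"
  unfolding l2_linear_def
proof (intro conjI ballI allI funcsetI)
  fix \<mu> assume \<mu>: "\<mu> \<in> l2_space w"
  show "matrix_action P \<mu> \<in> l2_space w"
  proof (rule l2_space_boxI[OF w_pos])
    show "summable (\<lambda>j. (l2_norm w \<mu>)\<^sup>2 * 36 * (1 / q) ^ j)"
      using q_gt1 by (intro summable_mult summable_geometric) simp
    show "(cmod (matrix_action P \<mu> j))\<^sup>2 \<le> (l2_norm w \<mu>)\<^sup>2 * 36 * (1 / q) ^ j * w j" for j
      using matrix_action_P_bound[OF \<mu>, of j] by (simp add: power_divide mult.assoc)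
  qed
next
  fix \<mu> \<nu> :: "nat \<Rightarrow> complex" and a b :: complex
  show "matrix_action P (\<lambda>i. a * \<mu> i + b * \<nu> i)
      = (\<lambda>i. a * matrix_action P \<mu> i + b * matrix_action P \<nu> i)" (is "?l = ?r")
  proof
    show "?l j = ?r j" for j
      by (cases j) (simp_all add: matrix_action_P_0 matrix_action_P_Suc algebra_simps)
  qed
qed

lemma compact_P: "l2_compact_operator w (matrix_action P)"
proof (rule l2_compact_operatorI[OF w_pos _ l2_linear_P matrix_action_P_bound])
  have "summable (\<lambda>j. 36 * (1 / q) ^ j)"
    using q_gt1 by (intro summable_mult summable_geometric) simp
  then show "summable (\<lambda>j. 36 / q ^ j)"
    by (simp add: power_divide)
qed (use q_pos in auto)

subsection \<open>Triangular action on polynomials and the point spectrum\<close>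

text \<open>This is \<open>e_k\<close>; for a prime power \<open>q\<close> it counts the injective
  linear maps from a \<open>k\<close>-dimensional to an \<open>i\<close>-dimensional space over the
  field with \<open>q\<close> elements.\<close>

definition qfall :: "nat \<Rightarrow> nat \<Rightarrow> real" where
  "qfall k i = (\<Prod>l<k. q ^ i - q ^ l)"

lemma qfall_0 [simp]: "qfall 0 i = 1"
  by (simp add: qfall_def)

lemma qfall_Suc: "qfall (Suc k) i = qfall k i * (q ^ i - q ^ k)"
  by (simp add: qfall_def)

lemma qfall_eq_0: "i < k \<Longrightarrow> qfall k i = 0"
  by (auto simp: qfall_def intro!: prod_zero)

text \<open>The factor at \<open>l = 0\<close> is split off and a \<open>q\<close> is taken out of
  each other factor. Together with \<open>qfall_Suc\<close> this links the values at
  \<open>i - 1\<close>, \<open>i\<close> and \<open>i + 1\<close>.\<close>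

lemma qfall_Suc_Suc: "qfall (Suc k) (Suc i) = (q ^ Suc i - 1) * q ^ k * qfall k i"
proof -
  have "qfall (Suc k) (Suc i) = (q ^ Suc i - 1) * (\<Prod>l<k. q * (q ^ i - q ^ l))"
    unfolding qfall_def by (subst prod.lessThan_Suc_shift) (simp add: algebra_simps)
  then show ?thesis
    by (simp add: prod.distrib qfall_def)
qed

lemma geom_bounded_qfall: "geom_bounded q (qfall k)"
  unfolding qfall_def by (intro geom_bounded_prod geom_bounded_power_diff q_ge1)

text \<open>At \<open>i = 0\<close> the truncated \<open>i - 1\<close> is harmless because \<open>down 0 = 0\<close>.\<close>

abbreviation gen :: "(nat \<Rightarrow> real) \<Rightarrow> nat \<Rightarrow> real" where
  "gen f i \<equiv> up i * f (Suc i) + stay i * f i + down i * f (i - 1)"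

lemma gen_qfall_0: "gen (qfall 0) i = 1"
  by (simp add: stay_def)

text \<open>For positive \<open>i\<close> all three values are multiples of
  \<open>B = qfall k i\<close> once \<open>A = qfall k (i - 1)\<close> is eliminated; the rest is a
  rational identity in \<open>x\<close>, \<open>y\<close>, \<open>u\<close> and \<open>q\<close>. At
  \<open>i = 0\<close> every term vanishes unless \<open>k = 0\<close>.\<close>

lemma gen_qfall_Suc:
  "gen (qfall (Suc k)) i
    = qfall (Suc k) i / q ^ Suc k + (1 - 1 / q ^ Suc k) / q ^ m * qfall k i"
proof (cases i)
  case 0
  have up0: "up 0 = 1 / (q * q ^ m)"
    by (simp add: up_def)
  show ?thesis
  proof (cases k)
    case 0
    then show ?thesis
      using \<open>i = 0\<close> q_nz by (simp add: up0 qfall_Suc field_simps)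
  next
    case (Suc k')
    then have "qfall k 0 = 0" by (simp add: qfall_eq_0)
    then show ?thesis
      using \<open>i = 0\<close> by (simp add: qfall_Suc_Suc qfall_Suc[of k 0])
  qed
next
  case (Suc i')
  define x y u A B where "x = q ^ i" and "y = q ^ k" and "u = q ^ m"
    and "A = qfall k i'" and "B = qfall k i"
  have nz: "x \<noteq> 0" "y \<noteq> 0" "u \<noteq> 0"
    using q_nz by (auto simp: x_def y_def u_def)
  have factor: "U * (a * B) + V * (B * b) + W * (B * b) = B * (U * a + V * b + W * b)"
    for U V W a b :: real
    by (simp add: algebra_simps)
  have AB: "(x - 1) * y * A = B * (x - y)"
    using qfall_Suc_Suc[of k i'] qfall_Suc[of k i] by (simp add: Suc x_def y_def A_def B_def)
  have f: "qfall (Suc k) (Suc i) = (q * x - 1) * y * B" "qfall (Suc k) i = B * (x - y)"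
      "qfall (Suc k) (i - 1) = A * (x / q - y)"
    using qfall_Suc_Suc[of k i] qfall_Suc[of k i] qfall_Suc[of k i'] q_nz
    by (simp_all add: Suc x_def y_def A_def B_def)
  have up: "up i = 1 / (x * x * u * q)"
    by (simp add: up_def x_def u_def power_add mult_2)
  have down: "down i = (x - 1) / x * (1 - 1 / (u * x))"
    using nz by (simp add: down_def x_def u_def power_add field_simps)
  \<comment> \<open>The factor \<open>x - 1\<close> of \<open>down i\<close> completes
    \<open>A\<close> to the left side of \<open>AB\<close>, so \<open>A\<close> can be traded for
    \<open>B\<close>.\<close>
  have "down i * qfall (Suc k) (i - 1) = (1 - 1 / (u * x)) * (x / q - y) / (x * y) * ((x - 1) * y * A)"
    unfolding f(3) down using nz by simp
  also have "\<dots> = (1 - 1 / (u * x)) * (x / q - y) / (x * y) * (B * (x - y))"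
    by (simp only: AB)
  finally have d: "down i * qfall (Suc k) (i - 1)
      = (1 - 1 / (u * x)) * (x / q - y) / (x * y) * (B * (x - y))" (is "_ = ?E * _") .
  have "gen (qfall (Suc k)) i
      = up i * ((q * x - 1) * y * B) + (1 - down i - up i) * (B * (x - y)) + ?E * (B * (x - y))"
    by (simp only: stay_def f(1,2) d)
  also have "\<dots> = B * (up i * ((q * x - 1) * y) + (1 - down i - up i) * (x - y) + ?E * (x - y))"
    by (rule factor)
  also have "up i * ((q * x - 1) * y) + (1 - down i - up i) * (x - y) + ?E * (x - y)
      = (x - y) / (q * y) + (1 - 1 / (q * y)) / u"
    unfolding up down using nz q_nz by (simp add: field_simps)
  also have "B * \<dots> = qfall (Suc k) i / q ^ Suc k + (1 - 1 / q ^ Suc k) / q ^ m * qfall k i"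
    unfolding f(2) by (simp add: y_def u_def B_def algebra_simps)
  finally show ?thesis .
qed

section \<open>Moments of eigenvectors and exclusion of other eigenvalues\<close>

text \<open>Summation by shifting: the three diagonals give three convergent series, and reindexing
  two of them moves the operator from \<open>\<mu>\<close> onto the test function.\<close>

lemma matrix_action_P_sums:
  fixes \<mu> :: "nat \<Rightarrow> complex"
  assumes s: "1 < s" "q = s\<^sup>2" and \<mu>: "\<And>i. cmod (\<mu> i) \<le> C / s ^ (i * i)" and f: "geom_bounded q f"
  shows "(\<lambda>j. matrix_action P \<mu> j * of_real (f j)) sums (\<Sum>i. \<mu> i * of_real (gen f i))"
proof -
  let ?U = "\<lambda>i. \<mu> i * of_real (up i * f (Suc i))"
    and ?S = "\<lambda>i. \<mu> i * of_real (stay i * f i)"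
    and ?D = "\<lambda>i. \<mu> i * of_real (down i * f (i - 1))"
  have summ: "summable (\<lambda>i. \<mu> i * of_real (g i * h i))"
    if "\<And>i. \<bar>g i\<bar> \<le> 2" "geom_bounded q h" for g h
  proof -
    have "geom_bounded q g"
      unfolding geom_bounded_def using that(1) by (intro exI[of _ 2] exI[of _ 0]) auto
    then have "geom_bounded (s\<^sup>2) (\<lambda>i. g i * h i)"
      using that(2) s(2) by (auto intro: geom_bounded_mult)
    then show ?thesis
      by (rule summable_gaussian_geom_bounded[OF s(1) \<mu>])
  qed
  have b: "\<bar>up i\<bar> \<le> 2" "\<bar>down i\<bar> \<le> 2" "\<bar>stay i\<bar> \<le> 2" for i
    using up_le(3)[of i] up_pos[of i] down_nonneg[of i] down_le_1[of i] by (auto simp: stay_def)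
  have U: "summable ?U" and S: "summable ?S" and D: "summable ?D"
    by (intro summ b f geom_bounded_Suc geom_bounded_pred q_ge1)+
  \<comment> \<open>The mass that \<open>i\<close> sends up arrives at \<open>Suc i\<close>, so the
    series is shifted by one place and 0 is put in front.\<close>
  define U' where "U' j = (case j of 0 \<Rightarrow> 0 | Suc i \<Rightarrow> ?U i)" for j
  have U': "U' sums suminf ?U"
    using summable_sums[OF U] sums_Suc_iff[of U' "suminf ?U"] by (simp add: U'_def)
  \<comment> \<open>The shift in the other direction loses the term at 0, which vanishes because
    \<open>down 0 = 0\<close>.\<close>
  have D': "(\<lambda>j. ?D (Suc j)) sums suminf ?D"
    using summable_sums[OF D] by (subst sums_Suc_iff) simp
  have "(\<lambda>j. U' j + ?S j + ?D (Suc j)) sums (suminf ?U + suminf ?S + suminf ?D)"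
    by (intro sums_add U' D' summable_sums S)
  moreover have "U' j + ?S j + ?D (Suc j) = matrix_action P \<mu> j * of_real (f j)" for j
    by (cases j) (simp_all add: U'_def matrix_action_P_0 matrix_action_P_Suc algebra_simps)
  moreover have "suminf ?U + suminf ?S + suminf ?D = (\<Sum>i. \<mu> i * of_real (gen f i))"
    using U S D by (simp add: suminf_add summable_add algebra_simps)
  ultimately show ?thesis by simp
qed

text \<open>Pairing the eigenvalue equation with \<open>qfall (Suc k)\<close> gives
  \<open>(c - 1 / q ^ Suc k)\<close> times its moment as a multiple of the previous moment.
  Induction divides by the nonzero factor; the start uses that \<open>c\<close> is not 1.\<close>

lemma qfall_moments_zero:
  assumes s: "1 < s" "q = s\<^sup>2" and \<mu>: "\<And>i. cmod (\<mu> i) \<le> C / s ^ (i * i)"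
    and ev: "matrix_action P \<mu> = (\<lambda>i. c * \<mu> i)" and c: "\<And>k. c \<noteq> 1 / of_real q ^ k"
  shows "(\<Sum>i. \<mu> i * of_real (qfall k i)) = 0"
proof -
  have summ: "summable (\<lambda>i. \<mu> i * of_real (f i))" if "geom_bounded q f" for f
    using that s(2) by (auto intro: summable_gaussian_geom_bounded[OF s(1) \<mu>])
  have act: "c * (\<Sum>i. \<mu> i * of_real (f i)) = (\<Sum>i. \<mu> i * of_real (gen f i))"
    if "geom_bounded q f" for f
  proof -
    have "(\<lambda>j. c * (\<mu> j * of_real (f j))) sums (\<Sum>i. \<mu> i * of_real (gen f i))"
      using matrix_action_P_sums[OF s \<mu> that] by (simp add: ev mult.assoc)
    then show ?thesis
      by (rule sums_unique2[OF sums_mult[OF summable_sums[OF summ[OF that]]]])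
  qed
  show ?thesis
  proof (induction k)
    case 0
    have "c * (\<Sum>i. \<mu> i * of_real (qfall 0 i)) = (\<Sum>i. \<mu> i * of_real (qfall 0 i))"
      unfolding act[OF geom_bounded_qfall] gen_qfall_0 by simp
    then show ?case using c[of 0] by simp
  next
    case (Suc k)
    let ?M = "\<Sum>i. \<mu> i * of_real (qfall (Suc k) i)"
    have "c * ?M = (\<Sum>i. of_real (1 / q ^ Suc k) * (\<mu> i * of_real (qfall (Suc k) i))
        + of_real ((1 - 1 / q ^ Suc k) / q ^ m) * (\<mu> i * of_real (qfall k i)))"
      unfolding act[OF geom_bounded_qfall] gen_qfall_Suc by (simp add: algebra_simps)
    also have "\<dots> = of_real (1 / q ^ Suc k) * ?M
        + of_real ((1 - 1 / q ^ Suc k) / q ^ m) * (\<Sum>i. \<mu> i * of_real (qfall k i))"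
      using summ[OF geom_bounded_qfall]
      by (simp only: suminf_add[symmetric] suminf_mult summable_mult)
    finally have "(c - 1 / of_real q ^ Suc k) * ?M = 0"
      by (simp add: Suc.IH algebra_simps)
    then show ?case using c[of "Suc k"] by simp
  qed
qed

text \<open>Writing \<open>q ^ i - a n\<close> as \<open>(q ^ i - q ^ k) + (q ^ k - a n)\<close>
  reduces one more root to the moments for \<open>Suc k\<close> and \<open>k\<close>; hence the
  induction keeps \<open>k\<close> arbitrary.\<close>

lemma root_product_moments_zero:
  fixes n :: nat
  assumes s: "1 < s" "q = s\<^sup>2" and \<mu>: "\<And>i. cmod (\<mu> i) \<le> C / s ^ (i * i)"
    and mom: "\<And>k. (\<Sum>i. \<mu> i * of_real (qfall k i)) = 0"
  shows "(\<Sum>i. \<mu> i * of_real ((\<Prod>l<n. q ^ i - a l) * qfall k i)) = 0"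
proof (induction n arbitrary: k)
  case 0
  then show ?case by (simp add: mom)
next
  case (Suc n)
  let ?R = "\<lambda>i. \<Prod>l<n. q ^ i - a l"
  have summ: "summable (\<lambda>i. \<mu> i * of_real (?R i * qfall k i))" for k
    by (intro summable_gaussian_geom_bounded[OF s(1) \<mu>, folded s(2)] geom_bounded_mult
      geom_bounded_qfall geom_bounded_prod geom_bounded_power_diff q_ge1)
  have "(\<Sum>i. \<mu> i * of_real ((\<Prod>l<Suc n. q ^ i - a l) * qfall k i))
      = (\<Sum>i. \<mu> i * of_real (?R i * qfall (Suc k) i)
          + of_real (q ^ k - a n) * (\<mu> i * of_real (?R i * qfall k i)))"
    by (simp add: qfall_Suc algebra_simps)
  also have "\<dots> = (\<Sum>i. \<mu> i * of_real (?R i * qfall (Suc k) i))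
      + of_real (q ^ k - a n) * (\<Sum>i. \<mu> i * of_real (?R i * qfall k i))"
    by (simp only: suminf_add[symmetric] suminf_mult summable_mult summ)
  finally show ?case by (simp only: Suc.IH mult_zero_right add_0_right)
qed


text \<open>
  The test polynomial with roots \<open>q, \<dots>, q ^ N\<close> isolates \<open>\<mu> 0\<close>: its value at \<open>1\<close> has order
  \<open>s ^ (N\<^sup>2 + N)\<close>, while the Gaussian decay leaves only \<open>s ^ (N\<^sup>2)\<close> for the terms beyond \<open>N\<close>.
\<close>

lemma coordinate_0_eq_0:
  assumes s: "1 < s" "q = s\<^sup>2" and \<mu>: "\<And>i. cmod (\<mu> i) \<le> C / s ^ (i * i)"
    and mom: "\<And>k. (\<Sum>i. \<mu> i * of_real (qfall k i)) = 0"
  shows "\<mu> 0 = 0"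
proof (rule ccontr)
  assume "\<mu> 0 \<noteq> 0"
  let ?e = "eta q \<infinity>" and ?K = "C * (1 / (1 - 1 / s))"
  have C: "0 \<le> C"
    using order_trans[OF norm_ge_zero \<mu>[of 0]] by simp
  have "cmod (\<mu> 0) * ?e * s ^ N \<le> ?K" for N
  proof -
    define p where "p i = (\<Prod>l<N. q ^ i - q ^ Suc l)" for i
    let ?f = "\<lambda>i. \<mu> i * of_real (p i)"
    have summ: "summable ?f"
      unfolding p_def
      by (intro summable_gaussian_geom_bounded[OF s(1) \<mu>, folded s(2)] geom_bounded_prod
        geom_bounded_power_diff q_ge1)
    have "suminf ?f = 0"
      using root_product_moments_zero[OF s \<mu> mom, where n = N and a = "\<lambda>l. q ^ Suc l" and k = 0]
      by (simp add: p_def)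
    \<comment> \<open>The roots of \<open>p\<close> remove the indices 1 to
      \<open>N\<close>.\<close>
    moreover have "sum ?f {..<Suc N} = ?f 0"
    proof -
      have "p (Suc i) = 0" if "i < N" for i
        unfolding p_def using that by (intro prod_zero) auto
      then show ?thesis
        unfolding sum.lessThan_Suc_shift by simp
    qed
    ultimately have "?f 0 = - (\<Sum>r. ?f (r + Suc N))"
      using suminf_split_initial_segment[OF summ, of "Suc N"] by (simp add: add_eq_0_iff)
    then have "cmod (?f 0) = cmod (\<Sum>r. ?f (r + Suc N))"
      by (simp only: norm_minus_cancel)
    also have "\<dots> \<le> C * s ^ (N * N) * (1 / (1 - 1 / s))"
    proof (rule suminf_gaussian_tail_le[OF s(1) C])
      fix i assume i: "N < i"
      \<comment> \<open>Beyond \<open>N\<close> no root exceeds \<open>q ^ i\<close>, so each factor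
        lies between 0 and \<open>q ^ i\<close>.\<close>
      have "\<bar>p i\<bar> \<le> (\<Prod>l<N. q ^ i)"
        unfolding p_def abs_prod
      proof (rule prod_mono, intro conjI abs_ge_zero)
        fix l assume "l \<in> {..<N}"
        then have "q ^ Suc l \<le> q ^ i"
          using i by (intro power_increasing q_ge1) auto
        moreover have "0 \<le> q ^ Suc l"
          using q_pos by simp
        ultimately show "\<bar>q ^ i - q ^ Suc l\<bar> \<le> q ^ i"
          by linarith
      qed
      also have "\<dots> = s ^ (2 * N * i)"
        by (simp add: s(2) power_mult[symmetric] mult.commute mult.left_commute)
      finally show "cmod (?f i) \<le> C / s ^ (i * i) * s ^ (2 * N * i)"
        unfolding norm_mult norm_of_real using \<mu>[of i] C s(1) by (intro mult_mono) auto
    qed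
    also have "\<dots> = ?K * s ^ (N * N)"
      by simp
    finally have le: "cmod (?f 0) \<le> ?K * s ^ (N * N)" .
    \<comment> \<open>Extracting the root from each factor leaves exactly the factors of
      \<open>eta q (enat N)\<close>, which stay above the positive limit.\<close>
    have "p 0 = (\<Prod>l<N. - (q ^ Suc l * (1 - 1 / q ^ Suc l)))"
      unfolding p_def by (rule prod.cong) (use q_nz in \<open>simp_all add: right_diff_distrib\<close>)
    then have "\<bar>p 0\<bar> = (\<Prod>l<N. q ^ Suc l) * eta q (enat N)"
      using power_factor_pos q_pos
      by (simp add: abs_prod abs_mult eta_enat prod.distrib abs_of_pos del: power_Suc)
    \<comment> \<open>The exponents of \<open>q\<close> add up to \<open>N * (N + 1) / 2\<close>,
      doubled by \<open>q = s^2\<close>.\<close>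
    also have "(\<Prod>l<N. q ^ Suc l) = s ^ (N * N + N)"
      by (induction N) (simp_all add: s(2) power_add power_mult_distrib power2_eq_square)
    finally have "s ^ (N * N + N) * ?e \<le> \<bar>p 0\<bar>"
      using eta_infinity_le[of N] s(1) by simp
    then have "cmod (\<mu> 0) * (s ^ (N * N + N) * ?e) \<le> cmod (?f 0)"
      by (simp add: norm_mult mult_left_mono)
    with le have "(cmod (\<mu> 0) * ?e * s ^ N) * s ^ (N * N) \<le> ?K * s ^ (N * N)"
      by (simp add: power_add mult_ac)
    then show ?thesis
      using s(1) by (simp only: mult_le_cancel_right) simp
  qed
  moreover obtain N where "?K / (cmod (\<mu> 0) * ?e) < s ^ N"
    using real_arch_pow[OF s(1)] by blast
  moreover have pos: "0 < cmod (\<mu> 0) * ?e"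
    using \<open>\<mu> 0 \<noteq> 0\<close> eta_infinity_pos by simp
  ultimately show False
    unfolding pos_divide_less_eq[OF pos] by (metis mult.commute not_le)
qed

text \<open>Coordinate \<open>j\<close> of the eigenvalue equation determines
  \<open>\<mu> (Suc j)\<close> from earlier entries, as \<open>down (Suc j)\<close> is
  positive.\<close>

lemma eigenvector_eq_0:
  assumes ev: "matrix_action P \<mu> = (\<lambda>i. c * \<mu> i)" and "\<mu> 0 = 0"
  shows "\<mu> = (\<lambda>i. 0)"
proof -
  have "\<mu> j = 0 \<and> \<mu> (Suc j) = 0" for j
  proof (induction j)
    case 0
    show ?case
      using fun_cong[OF ev, of 0] \<open>\<mu> 0 = 0\<close> down_Suc_pos[of 0] by (simp add: matrix_action_P_0)
  next
    case (Suc j)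
    then show ?case
      using fun_cong[OF ev, of "Suc j"] down_Suc_pos[of "Suc j"] by (simp add: matrix_action_P_Suc)
  qed
  then show ?thesis by auto
qed

lemma eigenvalueD:
  assumes "c \<in> l2_eigenvalues w (matrix_action P)"
  shows "\<exists>k. c = 1 / of_real q ^ k"
proof (rule ccontr)
  assume "\<nexists>k. c = 1 / of_real q ^ k"
  then have c: "c \<noteq> 1 / of_real q ^ k" for k
    by blast
  obtain \<mu> where \<mu>: "\<mu> \<in> l2_space w" "\<mu> \<noteq> (\<lambda>i. 0)"
    and ev: "matrix_action P \<mu> = (\<lambda>i. c * \<mu> i)"
    using assms unfolding l2_eigenvalues_def by blast
  have s: "1 < sqrt q" "q = (sqrt q)\<^sup>2"
    using q_gt1 by auto
  obtain C where C: "\<And>i. cmod (\<mu> i) \<le> C / sqrt q ^ (i * i)"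
    using l2_space_gaussian_bound[OF s(1) w_pos _ \<mu>(1), folded s(2)] w_le by blast
  have "\<mu> 0 = 0"
    by (rule coordinate_0_eq_0[OF s C qfall_moments_zero[OF s C ev c]])
  with eigenvector_eq_0[OF ev] \<mu>(2) show False
    by blast
qed

section \<open>Polynomial eigenfunctions\<close>

text \<open>Solution, normalised to 1 at \<open>j = 0\<close>, of the recursion obtained by
  comparing coefficients of \<open>qfall j\<close> in the eigenvalue equation for
  \<open>1 / q ^ k\<close>. The factor at \<open>l = k\<close> vanishes, so the expansion stops at
  degree \<open>k\<close>.\<close>

definition efun_coeff :: "nat \<Rightarrow> nat \<Rightarrow> real" where
  "efun_coeff k j = (\<Prod>l<j. q ^ m * (1 / q ^ k - 1 / q ^ l) / (1 - 1 / q ^ Suc l))"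

definition efun :: "nat \<Rightarrow> nat \<Rightarrow> real" where
  "efun k i = (\<Sum>j\<le>k. efun_coeff k j * qfall j i)"

lemma efun_coeff_Suc:
  "efun_coeff k (Suc j) * ((1 - 1 / q ^ Suc j) / q ^ m) = (1 / q ^ k - 1 / q ^ j) * efun_coeff k j"
proof -
  have "1 - 1 / q ^ Suc j \<noteq> 0"
    using power_factor_pos[of j] by (metis less_irrefl)
  then show ?thesis
    using q_nz by (simp add: efun_coeff_def del: power_Suc)
qed

text \<open>Every \<open>qfall j\<close> with positive \<open>j\<close> vanishes at 0. This value
  certifies that the eigenfunction is nonzero.\<close>

lemma efun_0: "efun k 0 = 1"
  unfolding efun_def sum.atMost_shift by (simp add: efun_coeff_def qfall_eq_0)

lemma gen_efun: "gen (efun k) i = efun k i / q ^ k"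
proof -
  have "gen (efun k) i = (\<Sum>j\<le>k. efun_coeff k j * gen (qfall j) i)"
    unfolding efun_def by (simp add: sum_distrib_left sum.distrib algebra_simps)
  also have "\<dots> = (\<Sum>j\<le>k. efun_coeff k j * (qfall j i / q ^ j)
      + efun_coeff k j * ((1 - 1 / q ^ j) / q ^ m) * qfall (j - 1) i)"
  proof (rule sum.cong)
    show "efun_coeff k j * gen (qfall j) i = efun_coeff k j * (qfall j i / q ^ j)
        + efun_coeff k j * ((1 - 1 / q ^ j) / q ^ m) * qfall (j - 1) i" for j
      by (cases j) (simp_all only: gen_qfall_0 gen_qfall_Suc, simp_all add: distrib_left)
  qed simp
  \<comment> \<open>The term \<open>j = 0\<close> of the second sum drops out since
    \<open>1 - 1 / q ^ 0 = 0\<close>, so the truncated \<open>j - 1\<close> is harmless.\<close>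
  also have "\<dots> = (\<Sum>j\<le>k. efun_coeff k j * (qfall j i / q ^ j))
      + (\<Sum>j<k. efun_coeff k (Suc j) * ((1 - 1 / q ^ Suc j) / q ^ m) * qfall j i)"
    unfolding sum.distrib sum.atMost_shift[of "\<lambda>j. _ j * qfall (j - 1) i"] by simp
  \<comment> \<open>The range may be extended to \<open>j = k\<close>, where
    \<open>1 / q ^ k - 1 / q ^ j\<close> is 0.\<close>
  also have "(\<Sum>j<k. efun_coeff k (Suc j) * ((1 - 1 / q ^ Suc j) / q ^ m) * qfall j i)
      = (\<Sum>j\<le>k. (1 / q ^ k - 1 / q ^ j) * efun_coeff k j * qfall j i)"
    unfolding efun_coeff_Suc by (simp add: lessThan_Suc_atMost[symmetric])
  also have "(\<Sum>j\<le>k. efun_coeff k j * (qfall j i / q ^ j)) + \<dots> = efun k i / q ^ k"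
    unfolding efun_def by (simp add: sum.distrib[symmetric] sum_divide_distrib algebra_simps)
  finally show ?thesis .
qed

text \<open>By detailed balance, multiplication by \<open>w\<close> carries the action on functions
  to the action on measures, so eigenfunctions of \<open>gen\<close> yield eigenvectors.\<close>

lemma matrix_action_P_reversible:
  "matrix_action P (\<lambda>i. of_real (w i * h i)) = (\<lambda>j. of_real (w j * gen h j))"
proof
  fix j
  have db: "w (Suc i) * h (Suc i) * down (Suc i) = w i * (up i * h (Suc i))"
    "w i * h i * up i = w (Suc i) * (down (Suc i) * h i)" for i
    using detailed_balance[of i] by (simp_all add: mult_ac)
  show "matrix_action P (\<lambda>i. of_real (w i * h i)) j = of_real (w j * gen h j)"
    unfolding of_real_mult[symmetric] of_real_add[symmetric]
    by (cases j) (simp_all only: matrix_action_P_0 matrix_action_P_Suc One_nat_def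
      of_real_mult[symmetric] of_real_add[symmetric] db, simp_all add: algebra_simps)
qed

text \<open>The squared norm of \<open>w * efun k\<close> is the sum of
  \<open>w i * (efun k i)^2\<close>, finite because Gaussian decay beats polynomial growth in
  \<open>q ^ i\<close>.\<close>

lemma eigenvalueI: "1 / of_real q ^ k \<in> l2_eigenvalues w (matrix_action P)"
proof -
  define \<mu> :: "nat \<Rightarrow> complex" where "\<mu> i = of_real (w i * efun k i)" for i
  have s: "1 < sqrt q" "q = (sqrt q)\<^sup>2"
    using q_gt1 by auto
  have "geom_bounded q (efun k)"
    unfolding efun_def
    by (intro geom_bounded_sum geom_bounded_mult geom_bounded_const geom_bounded_qfall q_ge1)
  then have "geom_bounded q (\<lambda>i. (efun k i)\<^sup>2)"
    unfolding power2_eq_square by (intro geom_bounded_mult)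
  \<comment> \<open>The decay of the weight is weakened from base \<open>q\<close> to base
    \<open>sqrt q\<close>, whose square is the base of the growth class.\<close>
  moreover have "cmod (of_real (w i)) \<le> (1 / eta q \<infinity>) / sqrt q ^ (i * i)" for i
  proof -
    have "sqrt q ^ (i * i) \<le> q ^ (i * i)"
      using q_ge1 by (intro power_mono real_le_lsqrt) (auto simp: self_le_power)
    then have "(1 / eta q \<infinity>) / q ^ (i * i) \<le> (1 / eta q \<infinity>) / sqrt q ^ (i * i)"
      using eta_infinity_pos q_pos by (intro divide_left_mono) auto
    with w_le[of i] w_pos[of i] show ?thesis by simp
  qed
  ultimately have "summable (\<lambda>i. complex_of_real (w i) * of_real ((efun k i)\<^sup>2))"
    by (intro summable_gaussian_geom_bounded[OF s(1), folded s(2)])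
  then have "summable (\<lambda>i. w i * (efun k i)\<^sup>2)"
    by (simp only: of_real_mult[symmetric] summable_of_real_iff)
  moreover have "(cmod (\<mu> i))\<^sup>2 / w i = w i * (efun k i)\<^sup>2" for i
    using w_pos[of i] by (simp add: \<mu>_def norm_mult power_mult_distrib power2_eq_square)
  ultimately have "\<mu> \<in> l2_space w"
    by (simp add: l2_space_summable_iff[OF w_pos])
  moreover have "\<mu> \<noteq> (\<lambda>i. 0)"
  proof
    assume "\<mu> = (\<lambda>i. 0)"
    from fun_cong[OF this, of 0] show False
      using w_pos[of 0] by (simp add: \<mu>_def efun_0)
  qed
  moreover have "matrix_action P \<mu> = (\<lambda>i. 1 / of_real q ^ k * \<mu> i)"
    unfolding \<mu>_def matrix_action_P_reversible gen_efun by simp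
  ultimately show ?thesis
    unfolding l2_eigenvalues_def by blast
qed

end

theorem theorem6:
  fixes q m :: nat
  assumes "primepow q"
  shows "l2_compact_operator (pi_dist (real q) m) (matrix_action (P_matrix (real q) m))
    \<and> l2_eigenvalues (pi_dist (real q) m) (matrix_action (P_matrix (real q) m))
        = {of_nat q powi (- int k) | k :: nat. True}"
proof -
  interpret corank_chain "real q" m
    using primepow_gt_Suc_0[OF assms] by unfold_locales simp
  show ?thesis
    using compact_P eigenvalueD eigenvalueI by (fastforce simp: power_int_minus_divide)
qed

end
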